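(* If the security levels are identical, i.e. $\varphi_u=\varphi$ for every $u\in\mathcal{U}$, then $$z^*_{(\overline{\mathcal{M}})}=\varphi+(1-\varphi)\frac{r}{n^*}\ \le\ z^*_{(\mathcal{M})}\ \le\ \min\Big\{1,\ \varphi+(1-\varphi)\frac{r}{m^*}\Big\}.$$
   Context: Setting: $\mathcal{U}$ is a finite set of components and $\mathcal{X}$ a finite set of sensor locations. Each $u\in\mathcal{U}$ has a security level $\varphi_u\in[0,1)$. Each $x\in\mathcal{X}$ has a nonempty monitoring set $U_x\subseteq\mathcal{U}$; for $C\subseteq\mathcal{X}$, $U_C=\bigcup_{x\in C}U_x$; every component belongs to at least one monitoring set, i.e. $U_{\mathcal{X}}=\mathcal{U}$. A set cover is a $C\subseteq\mathcal{X}$ with $U_C=\mathcal{U}$, and $n^*$ is the minimum size of a set cover. A set packing is a $T\subseteq\mathcal{U}$ with $|T\cap U_x|\le1$ for all $x\in\mathcal{X}$, and $m^*$ is the maximum size of a set packing. The number of sensors is a positive integer $r$ with $r<n^*$. $\mathcal{A}=\{X\subseteq\mathcal{X} : |X|\le r\}$, and $\Delta^1$ is the set of probability distributions $\sigma^1$ on $\mathcal{A}$ (monitoring strategies), $\sigma^1_X$ being the probability of $X$. The node basis of $\sigma^1$ is $\mathcal{X}(\sigma^1)=\bigcup_{X:\sigma^1_X>0}X$. For $X\in\mathcal{A}$, $u\in\mathcal{U}$: $f(X,u)=1$ if $u\in U_X$ and $f(X,u)=\varphi_u$ otherwise. For $x\in\mathcal{X}$: $\overline{\varphi}_x=\min_{u\in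 U_x}\varphi_u$, and $\bar f(X,x)=1$ if $x\in X$, $\bar f(X,x)=\overline{\varphi}_x$ otherwise. $z^*_{(\mathcal{M})}=\max_{\sigma^1\in\Delta^1}\min_{u\in\mathcal{U}}\mathbb{E}_{X\sim\sigma^1}[f(X,u)]$, and $$z^*_{(\overline{\mathcal{M}})}=\max_{\sigma^1\in\Delta^1}\min\Big\{\min_{x\in\mathcal{X}(\sigma^1)}\mathbb{E}_{X\sim\sigma^1}[\bar f(X,x)],\ \min_{u\notin U_{\mathcal{X}(\sigma^1)}}\varphi_u\Big\},$$ where a minimum over an empty set is $+\infty$. *)

theory Defs
  imports "HOL-Probability.Probability"
begin

text \<open>
  Parameters used throughout: \<open>\<U>\<close> is the set of components, \<open>\<X>\<close> the set of sensor locations,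
  \<open>mon x\<close> the monitoring set of location \<open>x\<close>, \<open>phi u\<close> the security level of component \<open>u\<close>
  and \<open>r\<close> the number of sensors.
\<close>

definition monitored :: "('x \<Rightarrow> 'u set) \<Rightarrow> 'x set \<Rightarrow> 'u set" where
  "monitored mon C = (\<Union>x\<in>C. mon x)"

definition set_cover :: "'u set \<Rightarrow> 'x set \<Rightarrow> ('x \<Rightarrow> 'u set) \<Rightarrow> 'x set \<Rightarrow> bool" where
  "set_cover \<U> \<X> mon C \<longleftrightarrow> C \<subseteq> \<X> \<and> monitored mon C = \<U>"

definition set_packing :: "'u set \<Rightarrow> 'x set \<Rightarrow> ('x \<Rightarrow> 'u set) \<Rightarrow> 'u set \<Rightarrow> bool" where
  "set_packing \<U> \<X> mon T \<longleftrightarrow> T \<subseteq> \<U> \<and> (\<forall>x\<in>\<X>. card (T \<inter> mon x) \<le> 1)"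

definition min_cover_size :: "'u set \<Rightarrow> 'x set \<Rightarrow> ('x \<Rightarrow> 'u set) \<Rightarrow> nat" where
  "min_cover_size \<U> \<X> mon = Min (card ` {C. set_cover \<U> \<X> mon C})"

definition max_packing_size :: "'u set \<Rightarrow> 'x set \<Rightarrow> ('x \<Rightarrow> 'u set) \<Rightarrow> nat" where
  "max_packing_size \<U> \<X> mon = Max (card ` {T. set_packing \<U> \<X> mon T})"

definition placements :: "'x set \<Rightarrow> nat \<Rightarrow> 'x set set" where
  "placements \<X> r = {X. X \<subseteq> \<X> \<and> card X \<le> r}"

definition strategies :: "'x set \<Rightarrow> nat \<Rightarrow> 'x set pmf set" where
  "strategies \<X> r = {\<sigma>. set_pmf \<sigma> \<subseteq> placements \<X> r}"

definition node_basis :: "'x set pmf \<Rightarrow> 'x set" where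
  "node_basis \<sigma> = \<Union> (set_pmf \<sigma>)"

definition comp_payoff :: "('x \<Rightarrow> 'u set) \<Rightarrow> ('u \<Rightarrow> real) \<Rightarrow> 'x set \<Rightarrow> 'u \<Rightarrow> real" where
  "comp_payoff mon phi X u = (if u \<in> monitored mon X then 1 else phi u)"

definition min_level :: "('x \<Rightarrow> 'u set) \<Rightarrow> ('u \<Rightarrow> real) \<Rightarrow> 'x \<Rightarrow> real" where
  "min_level mon phi x = Min (phi ` mon x)"

definition loc_payoff :: "('x \<Rightarrow> 'u set) \<Rightarrow> ('u \<Rightarrow> real) \<Rightarrow> 'x set \<Rightarrow> 'x \<Rightarrow> real" where
  "loc_payoff mon phi X x = (if x \<in> X then 1 else min_level mon phi x)"

text \<open>
  The inner minima range over finite, possibly empty sets; they are written as infima in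
  \<^typ>\<open>ereal\<close>, so that the minimum over the empty set is \<open>\<infinity>\<close>.
\<close>

definition objective_M ::
    "'u set \<Rightarrow> ('x \<Rightarrow> 'u set) \<Rightarrow> ('u \<Rightarrow> real) \<Rightarrow> 'x set pmf \<Rightarrow> ereal" where
  "objective_M \<U> mon phi \<sigma> =
     (INF u\<in>\<U>. ereal (measure_pmf.expectation \<sigma> (\<lambda>X. comp_payoff mon phi X u)))"

definition objective_Mbar ::
    "'u set \<Rightarrow> ('x \<Rightarrow> 'u set) \<Rightarrow> ('u \<Rightarrow> real) \<Rightarrow> 'x set pmf \<Rightarrow> ereal" where
  "objective_Mbar \<U> mon phi \<sigma> =
     min (INF x\<in>node_basis \<sigma>.
            ereal (measure_pmf.expectation \<sigma> (\<lambda>X. loc_payoff mon phi X x)))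
         (INF u\<in>\<U> - monitored mon (node_basis \<sigma>). ereal (phi u))"

text \<open>
  The optimal values are genuine maxima rather than suprema: \<open>GREATEST\<close> only has a determined
  value when the maximum is attained.
\<close>

definition z_M ::
    "'u set \<Rightarrow> 'x set \<Rightarrow> ('x \<Rightarrow> 'u set) \<Rightarrow> ('u \<Rightarrow> real) \<Rightarrow> nat \<Rightarrow> ereal" where
  "z_M \<U> \<X> mon phi r = (GREATEST z. z \<in> objective_M \<U> mon phi ` strategies \<X> r)"

definition z_Mbar ::
    "'u set \<Rightarrow> 'x set \<Rightarrow> ('x \<Rightarrow> 'u set) \<Rightarrow> ('u \<Rightarrow> real) \<Rightarrow> nat \<Rightarrow> ereal" where
  "z_Mbar \<U> \<X> mon phi r = (GREATEST z. z \<in> objective_Mbar \<U> mon phi ` strategies \<X> r)"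

end

theory Submission
  imports Defs
begin

text \<open>
  When all security levels equal \<open>\<phi>\<close>, an expected payoff is \<open>\<phi> + (1 - \<phi>) * p\<close>, where \<open>p\<close> is the
  probability that the component is monitored, respectively that the location carries a sensor.
  So both problems ask for a random set of at most \<open>r\<close> sensors that makes the smallest such
  probability as large as possible.

  Both upper bounds come from double counting (\<open>exists_prob_le_average\<close>). The
  probabilities that the locations in the node basis carry a sensor add up to the expected number
  of sensors, so one of them is at most \<open>r\<close> divided by the size of the basis. If the basis is a set
  cover, its size is at least \<open>n\<^sup>*\<close>; if it is not, some component outside its reach contributes the
  value \<open>\<phi>\<close>, which is smaller still. In the same way, one sensor monitors at most one component of a
  set packing, so the detection probabilities over a maximum packing add up to at most \<open>r\<close>.

  Both lower bounds come from one strategy: choose a uniformly random \<open>r\<close>-subset of a minimum set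
  cover. Each location of the cover is chosen with probability \<open>r / n\<^sup>*\<close>
  (\<open>prob_mem_uniform_subset\<close>), and every component is monitored whenever a location
  of the cover that sees it is chosen.

  For \<open>z_Mbar\<close> this strategy exhibits the maximum. For \<open>z_M\<close> the two bounds need not meet, and the
  existence of a maximum is a compactness argument: a minimum of finitely many expectations is
  continuous on the simplex of distributions (\<open>exists_pmf_maximizing_min_expectation\<close>).
\<close>

section \<open>Existence of an optimal distribution\<close>

lemma continuous_on_INF_finite:
  fixes f :: "'i \<Rightarrow> 'a::topological_space \<Rightarrow> ereal"
  assumes "finite I" and "\<And>i. i \<in> I \<Longrightarrow> continuous_on A (f i)"
  shows "continuous_on A (\<lambda>x. INF i\<in>I. f i x)"
  using assms
proof (induction I rule: finite_induct)
  case empty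
  then show ?case by simp
next
  case (insert j I)
  then show ?case by (simp add: inf_min continuous_on_min)
qed

lemma compact_weights_on_finite:
  fixes S :: "'a set"
  assumes "finite S"
  shows "compact {w :: 'a \<Rightarrow> real. (\<forall>a. w a \<in> (if a \<in> S then {0..1} else {0})) \<and> sum w S = 1}"
proof -
  let ?box = "PiE UNIV (\<lambda>a. if a \<in> S then {0..1::real} else {0})"
  have "compactin (product_topology (\<lambda>_. euclidean) UNIV) ?box"
    by (simp add: compactin_PiE)
  then have "compact ?box"
    by (simp add: euclidean_product_topology)
  moreover have "closed {w :: 'a \<Rightarrow> real. sum w S = 1}"
    by (intro closed_Collect_eq continuous_on_sum continuous_on_const
        continuous_on_product_coordinates)
  ultimately have "compact (?box \<inter> {w. sum w S = 1})"
    by (rule compact_Int_closed)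
  moreover have "?box \<inter> {w. sum w S = 1} =
      {w. (\<forall>a. w a \<in> (if a \<in> S then {0..1} else {0})) \<and> sum w S = 1}"
    by (auto simp: PiE_def Pi_def)
  ultimately show ?thesis by simp
qed

text \<open>
  Distributions on a finite set are weight vectors in a compact simplex, on which a minimum of
  finitely many expectations is a continuous function.
\<close>

lemma exists_pmf_maximizing_min_expectation:
  fixes g :: "'a \<Rightarrow> 'i \<Rightarrow> real"
  assumes "finite S" and "S \<noteq> {}" and "finite I"
  shows "\<exists>p. set_pmf p \<subseteq> S \<and> (\<forall>q. set_pmf q \<subseteq> S \<longrightarrow>
      (INF i\<in>I. ereal (measure_pmf.expectation q (\<lambda>a. g a i)))
        \<le> (INF i\<in>I. ereal (measure_pmf.expectation p (\<lambda>a. g a i))))"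
proof -
  define K where
    "K = {w :: 'a \<Rightarrow> real. (\<forall>a. w a \<in> (if a \<in> S then {0..1} else {0})) \<and> sum w S = 1}"
  define G where "G w = (INF i\<in>I. ereal (\<Sum>a\<in>S. g a i * w a))" for w :: "'a \<Rightarrow> real"
  have expect: "(INF i\<in>I. ereal (measure_pmf.expectation q (\<lambda>a. g a i))) = G (pmf q)"
    if "set_pmf q \<subseteq> S" for q
    unfolding G_def using that \<open>finite S\<close>
    by (intro INF_cong refl arg_cong[where f = ereal] integral_measure_pmf_real) auto
  have pmf_in: "pmf q \<in> K" if "set_pmf q \<subseteq> S" for q
    unfolding K_def using that sum_pmf_eq_1[OF \<open>finite S\<close> that]
    by (auto simp: pmf_le_1 set_pmf_eq)
  have "continuous_on K (\<lambda>w. w a)" for a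
    by (rule continuous_on_subset[OF continuous_on_product_coordinates]) simp
  then have "continuous_on K G"
    unfolding G_def using \<open>finite I\<close>
    by (intro continuous_on_INF_finite continuous_on_ereal continuous_on_sum
        continuous_on_mult_left)
  moreover have "compact K"
    unfolding K_def by (rule compact_weights_on_finite[OF \<open>finite S\<close>])
  moreover obtain s where "s \<in> S" using \<open>S \<noteq> {}\<close> by blast
  then have "pmf (return_pmf s) \<in> K" by (intro pmf_in) simp
  then have "K \<noteq> {}" by blast
  ultimately obtain w where w: "w \<in> K" and max: "\<forall>v\<in>K. G v \<le> G w"
    using continuous_attains_sup[of K G] by blast
  have nonneg: "0 \<le> w a" for a
    using w unfolding K_def by (cases "a \<in> S") (auto dest: spec[of _ a])
  have zero: "w a = 0" if "a \<notin> S" for a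
    using w that unfolding K_def by (auto dest: spec[of _ a])
  have "(\<integral>\<^sup>+ a. ennreal (w a) \<partial>count_space UNIV) = (\<Sum>a\<in>S. ennreal (w a))"
    using \<open>finite S\<close> zero by (intro nn_integral_count_space') auto
  also have "\<dots> = 1"
    using w nonneg unfolding K_def by (simp add: sum_ennreal)
  finally have total: "(\<integral>\<^sup>+ a. ennreal (w a) \<partial>count_space UNIV) = 1" .
  define p where "p = embed_pmf w"
  have pmf_p: "pmf p = w"
    unfolding p_def using pmf_embed_pmf[OF nonneg total] by blast
  have "set_pmf p \<subseteq> S"
    unfolding set_pmf_eq pmf_p using zero by blast
  then show ?thesis
    using max pmf_in by (intro exI[of _ p]) (auto simp: expect pmf_p)
qed

section \<open>Double counting and uniform subsets\<close>

lemma integrable_indicator_pmf: "integrable (measure_pmf p) (indicator A :: 'a \<Rightarrow> real)"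
  by (rule measure_pmf.integrable_const_bound[where B = 1]) (auto simp: indicator_def)

text \<open>
  The probabilities of the events \<open>Q s\<close> add up to the expected number of events that occur, and
  the smallest of them is at most their average.
\<close>

lemma exists_prob_le_average:
  fixes p :: "'a pmf"
  assumes "finite S" and "S \<noteq> {}"
    and card: "\<And>X. X \<in> set_pmf p \<Longrightarrow> card {s \<in> S. Q s X} \<le> r"
  shows "\<exists>s\<in>S. measure_pmf.prob p {X. Q s X} \<le> real r / real (card S)"
proof (rule ccontr)
  assume "\<not> ?thesis"
  then have "(\<Sum>s\<in>S. real r / real (card S)) < (\<Sum>s\<in>S. measure_pmf.prob p {X. Q s X})"
    using assms by (intro sum_strict_mono) auto
  moreover have "(\<Sum>s\<in>S. real r / real (card S)) = real r"
    using assms by simp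
  moreover have "(\<Sum>s\<in>S. measure_pmf.prob p {X. Q s X})
      = measure_pmf.expectation p (\<lambda>X. \<Sum>s\<in>S. indicator {X. Q s X} X)"
    by (subst Bochner_Integration.integral_sum) (auto simp: integrable_indicator_pmf)
  moreover have "measure_pmf.expectation p (\<lambda>X. \<Sum>s\<in>S. indicator {X. Q s X} X) \<le> real r"
  proof (rule measure_pmf.integral_le_const)
    show "AE X in measure_pmf p. (\<Sum>s\<in>S. indicator {X. Q s X} X) \<le> real r"
    proof (rule AE_pmfI)
      fix X assume "X \<in> set_pmf p"
      have "(\<Sum>s\<in>S. indicator {X. Q s X} X) = real (card {s \<in> S. Q s X})"
        using \<open>finite S\<close> by (simp add: indicator_def sum.If_cases Int_def)
      then show "(\<Sum>s\<in>S. indicator {X. Q s X} X) \<le> real r"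
        using card[OF \<open>X \<in> set_pmf p\<close>] by simp
    qed
  qed (simp add: integrable_indicator_pmf)
  ultimately show False by linarith
qed

lemma finite_subsets_of_card:
  "finite C \<Longrightarrow> finite {X. X \<subseteq> C \<and> card X = r}"
  by (rule finite_subset[of _ "Pow C"]) auto

lemma subsets_of_card_nonempty:
  assumes "finite C" and "r \<le> card C"
  shows "{X. X \<subseteq> C \<and> card X = r} \<noteq> {}"
  using obtain_subset_with_card_n[OF assms(2)] by blast

text \<open>
  The \<open>r\<close>-subsets of \<open>C\<close> that avoid \<open>x\<close> are the \<open>r\<close>-subsets of \<open>C - {x}\<close>, and absorption of
  binomial coefficients gives the complementary probability \<open>(n - r) / n\<close>.
\<close>

lemma prob_mem_uniform_subset:
  assumes "finite C" and "r \<le> card C" and "x \<in> C"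
  shows "measure_pmf.prob (pmf_of_set {X. X \<subseteq> C \<and> card X = r}) {X. x \<in> X}
       = real r / real (card C)"
proof -
  let ?F = "{X. X \<subseteq> C \<and> card X = r}" and ?n = "card C"
  let ?p = "pmf_of_set ?F"
  have fin: "finite ?F" and ne: "?F \<noteq> {}"
    using assms finite_subsets_of_card subsets_of_card_nonempty by blast+
  have "?n > 0" using assms by (auto simp: card_gt_0_iff)
  have avoid: "?F \<inter> - {X. x \<in> X} = {X. X \<subseteq> C - {x} \<and> card X = r}" by auto
  have "measure_pmf.prob ?p (- {X. x \<in> X}) = real ((?n - 1) choose r) / real (?n choose r)"
    using assms
    by (simp add: measure_pmf_of_set[OF ne fin] avoid n_subsets)
  also have "\<dots> = real (?n - r) / real ?n"
  proof -
    have "real (?n - r) * real (?n choose r) = real ?n * real ((?n - 1) choose r)"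
      using binomial_absorb_comp[of ?n r] by (metis of_nat_mult)
    moreover have "?n choose r > 0" using assms by simp
    ultimately show ?thesis using \<open>?n > 0\<close> by (simp add: field_simps)
  qed
  finally have "1 - measure_pmf.prob ?p {X. x \<in> X} = real (?n - r) / real ?n"
    using measure_pmf.prob_compl[of "{X. x \<in> X}" ?p] by (simp add: Compl_eq_Diff_UNIV)
  moreover have "real (?n - r) / real ?n = 1 - real r / real ?n"
    using \<open>r \<le> ?n\<close> \<open>?n > 0\<close>
    by (simp add: of_nat_diff diff_divide_distrib del: card_gt_0_iff)
  ultimately show ?thesis by linarith
qed

section \<open>Set covers and set packings\<close>

lemma min_cover_size_le:
  assumes "finite \<X>" and "set_cover \<U> \<X> mon C"
  shows "min_cover_size \<U> \<X> mon \<le> card C"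
proof -
  have "finite {C. set_cover \<U> \<X> mon C}"
    using assms(1) by (auto simp: set_cover_def intro: finite_subset[of _ "Pow \<X>"])
  then show ?thesis
    unfolding min_cover_size_def using assms(2) by (intro Min_le) auto
qed

lemma obtain_min_cover:
  assumes "finite \<X>" and "monitored mon \<X> = \<U>"
  obtains C where "set_cover \<U> \<X> mon C" and "card C = min_cover_size \<U> \<X> mon"
proof -
  have "finite {C. set_cover \<U> \<X> mon C}"
    using assms(1) by (auto simp: set_cover_def intro: finite_subset[of _ "Pow \<X>"])
  moreover have "\<X> \<in> {C. set_cover \<U> \<X> mon C}"
    using assms(2) by (simp add: set_cover_def)
  ultimately have "min_cover_size \<U> \<X> mon \<in> card ` {C. set_cover \<U> \<X> mon C}"
    unfolding min_cover_size_def by (intro Min_in) auto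
  then show ?thesis using that by auto
qed

text \<open>
  A single component is a packing, so a maximum packing is nonempty; hence the quotient
  \<open>r / m\<^sup>*\<close> is a genuine one.
\<close>

lemma obtain_max_packing:
  assumes "finite \<U>" and "\<U> \<noteq> {}"
  obtains T where "set_packing \<U> \<X> mon T" and "T \<noteq> {}"
    and "card T = max_packing_size \<U> \<X> mon"
proof -
  let ?P = "{T. set_packing \<U> \<X> mon T}"
  have fin: "finite ?P"
    using assms(1) by (auto simp: set_packing_def intro: finite_subset[of _ "Pow \<U>"])
  obtain u where "u \<in> \<U>" using assms(2) by blast
  have "card ({u} \<inter> A) \<le> 1" for A
    using card_mono[of "{u}" "{u} \<inter> A"] by simp
  then have single: "{u} \<in> ?P"
    using \<open>u \<in> \<U>\<close> by (simp add: set_packing_def)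
  then have "max_packing_size \<U> \<X> mon \<in> card ` ?P"
    unfolding max_packing_size_def using fin by (intro Max_in) auto
  then obtain T where T: "set_packing \<U> \<X> mon T" "card T = max_packing_size \<U> \<X> mon"
    by auto
  have "card {u} \<le> max_packing_size \<U> \<X> mon"
    unfolding max_packing_size_def using fin by (intro Max_ge finite_imageI imageI single)
  then have "T \<noteq> {}" using T(2) by auto
  with T that show ?thesis by blast
qed

text \<open>Each sensor monitors at most one component of a packing.\<close>

lemma card_monitored_packing_le:
  assumes "set_packing \<U> \<X> mon T" and "X \<subseteq> \<X>" and "finite X"
  shows "card {u \<in> T. u \<in> monitored mon X} \<le> card X"
proof -
  have "{u \<in> T. u \<in> monitored mon X} = (\<Union>x\<in>X. T \<inter> mon x)"
    by (auto simp: monitored_def)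
  then have "card {u \<in> T. u \<in> monitored mon X} \<le> (\<Sum>x\<in>X. card (T \<inter> mon x))"
    using card_UN_le[OF \<open>finite X\<close>] by metis
  also have "\<dots> \<le> (\<Sum>x\<in>X. 1)"
    using assms by (intro sum_mono) (auto simp: set_packing_def)
  finally show ?thesis by simp
qed

section \<open>Payoffs under identical security levels\<close>

lemma expectation_if_const:
  "measure_pmf.expectation \<sigma> (\<lambda>X. if P X then 1 else c)
     = c + (1 - c) * measure_pmf.prob \<sigma> {X. P X}"
proof -
  have "measure_pmf.expectation \<sigma> (\<lambda>X. if P X then 1 else c)
      = measure_pmf.expectation \<sigma> (\<lambda>X. c + (1 - c) * indicator {X. P X} X)"
    by (intro Bochner_Integration.integral_cong) auto
  also have "\<dots> = c + (1 - c) * measure_pmf.prob \<sigma> {X. P X}"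
    by (subst Bochner_Integration.integral_add) (auto simp: integrable_indicator_pmf)
  finally show ?thesis .
qed

lemma expectation_comp_payoff:
  "phi u = \<phi> \<Longrightarrow> measure_pmf.expectation \<sigma> (\<lambda>X. comp_payoff mon phi X u)
     = \<phi> + (1 - \<phi>) * measure_pmf.prob \<sigma> {X. u \<in> monitored mon X}"
  unfolding comp_payoff_def by (simp add: expectation_if_const)

lemma expectation_loc_payoff:
  assumes "mon x \<noteq> {}" and "\<forall>u\<in>mon x. phi u = \<phi>"
  shows "measure_pmf.expectation \<sigma> (\<lambda>X. loc_payoff mon phi X x)
     = \<phi> + (1 - \<phi>) * measure_pmf.prob \<sigma> {X. x \<in> X}"
proof -
  have "phi ` mon x = {\<phi>}" using assms by auto
  then have "min_level mon phi x = \<phi>" by (simp add: min_level_def)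
  then show ?thesis
    unfolding loc_payoff_def by (simp add: expectation_if_const)
qed

lemma placement_finite:
  "finite \<X> \<Longrightarrow> \<sigma> \<in> strategies \<X> r \<Longrightarrow> X \<in> set_pmf \<sigma> \<Longrightarrow> X \<subseteq> \<X> \<and> finite X \<and> card X \<le> r"
  by (auto simp: strategies_def placements_def intro: finite_subset)

section \<open>Upper bounds\<close>

text \<open>
  If the node basis is not a cover, an unreachable component caps the objective at \<open>\<phi>\<close>; if it is
  one, the average sensor probability over the basis is at most \<open>r / n\<^sup>*\<close>.
\<close>

lemma objective_Mbar_le:
  assumes "finite \<X>" and "\<U> \<noteq> {}" and "\<phi> < 1"
    and mon: "\<forall>x\<in>\<X>. mon x \<noteq> {} \<and> mon x \<subseteq> \<U>"
    and phi: "\<forall>u\<in>\<U>. phi u = \<phi>"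
    and \<sigma>: "\<sigma> \<in> strategies \<X> r"
  shows "objective_Mbar \<U> mon phi \<sigma>
    \<le> ereal (\<phi> + (1 - \<phi>) * (real r / real (min_cover_size \<U> \<X> mon)))"
proof (cases "\<U> \<subseteq> monitored mon (node_basis \<sigma>)")
  case False
  then obtain u where u: "u \<in> \<U> - monitored mon (node_basis \<sigma>)" by blast
  then have "objective_Mbar \<U> mon phi \<sigma> \<le> ereal (phi u)"
    unfolding objective_Mbar_def by (intro min.coboundedI2 INF_lower)
  also have "\<dots> \<le> ereal (\<phi> + (1 - \<phi>) * (real r / real (min_cover_size \<U> \<X> mon)))"
    using u phi \<open>\<phi> < 1\<close> by simp
  finally show ?thesis .
next
  case True
  let ?B = "node_basis \<sigma>"
  have sub: "?B \<subseteq> \<X>"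
    using placement_finite[OF \<open>finite \<X>\<close> \<sigma>] unfolding node_basis_def by blast
  then have fin: "finite ?B" using \<open>finite \<X>\<close> finite_subset by blast
  have "monitored mon ?B \<subseteq> \<U>" using sub mon by (auto simp: monitored_def)
  then have cover: "set_cover \<U> \<X> mon ?B" using True sub by (auto simp: set_cover_def)
  have ne: "?B \<noteq> {}" using True \<open>\<U> \<noteq> {}\<close> by (auto simp: monitored_def)
  have "card {x \<in> ?B. x \<in> X} \<le> r" if "X \<in> set_pmf \<sigma>" for X
    using placement_finite[OF \<open>finite \<X>\<close> \<sigma> that] card_mono[of X "{x \<in> ?B. x \<in> X}"] by force
  then obtain x where x: "x \<in> ?B"
    and prob: "measure_pmf.prob \<sigma> {X. x \<in> X} \<le> real r / real (card ?B)"
    using exists_prob_le_average[OF fin ne, of \<sigma> "\<lambda>x X. x \<in> X" r] by blast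
  have "min_cover_size \<U> \<X> mon > 0"
  proof -
    have "monitored mon \<X> = \<U>" using cover sub mon by (auto simp: set_cover_def monitored_def)
    then obtain C where C: "set_cover \<U> \<X> mon C" "card C = min_cover_size \<U> \<X> mon"
      using obtain_min_cover[OF \<open>finite \<X>\<close>] by blast
    then have "C \<noteq> {}" and "finite C"
      using \<open>\<U> \<noteq> {}\<close> \<open>finite \<X>\<close> by (auto simp: set_cover_def monitored_def intro: finite_subset)
    then show ?thesis using C(2) by (metis card_gt_0_iff)
  qed
  then have "real r / real (card ?B) \<le> real r / real (min_cover_size \<U> \<X> mon)"
    using min_cover_size_le[OF \<open>finite \<X>\<close> cover] by (intro divide_left_mono) auto
  with prob have bound:
    "measure_pmf.prob \<sigma> {X. x \<in> X} \<le> real r / real (min_cover_size \<U> \<X> mon)" by linarith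
  have "objective_Mbar \<U> mon phi \<sigma>
      \<le> ereal (measure_pmf.expectation \<sigma> (\<lambda>X. loc_payoff mon phi X x))"
    unfolding objective_Mbar_def using x by (intro min.coboundedI1 INF_lower)
  also have "\<dots> = ereal (\<phi> + (1 - \<phi>) * measure_pmf.prob \<sigma> {X. x \<in> X})"
    using x sub mon phi by (subst expectation_loc_payoff[where \<phi> = \<phi>]) (auto dest!: bspec subsetD)
  also have "\<dots> \<le> ereal (\<phi> + (1 - \<phi>) * (real r / real (min_cover_size \<U> \<X> mon)))"
    using bound \<open>\<phi> < 1\<close> by (simp add: mult_left_mono del: times_divide_eq_right)
  finally show ?thesis .
qed

lemma objective_M_le:
  assumes "finite \<U>" and "finite \<X>" and "\<U> \<noteq> {}" and "\<phi> < 1"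
    and phi: "\<forall>u\<in>\<U>. phi u = \<phi>"
    and \<sigma>: "\<sigma> \<in> strategies \<X> r"
  shows "objective_M \<U> mon phi \<sigma>
    \<le> ereal (min 1 (\<phi> + (1 - \<phi>) * (real r / real (max_packing_size \<U> \<X> mon))))"
proof -
  obtain T where T: "set_packing \<U> \<X> mon T" "T \<noteq> {}" "card T = max_packing_size \<U> \<X> mon"
    using obtain_max_packing[OF \<open>finite \<U>\<close> \<open>\<U> \<noteq> {}\<close>] .
  have "T \<subseteq> \<U>" using T(1) by (simp add: set_packing_def)
  then have "finite T" using \<open>finite \<U>\<close> finite_subset by blast
  have "card {u \<in> T. u \<in> monitored mon X} \<le> r" if "X \<in> set_pmf \<sigma>" for X
    using placement_finite[OF \<open>finite \<X>\<close> \<sigma> that] card_monitored_packing_le[OF T(1)]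
    by (meson order_trans)
  then obtain u where "u \<in> T"
    and prob: "measure_pmf.prob \<sigma> {X. u \<in> monitored mon X} \<le> real r / real (card T)"
    using exists_prob_le_average[OF \<open>finite T\<close> T(2), of \<sigma> "\<lambda>u X. u \<in> monitored mon X" r]
    by blast
  with \<open>T \<subseteq> \<U>\<close> have "u \<in> \<U>" by blast
  let ?p = "measure_pmf.prob \<sigma> {X. u \<in> monitored mon X}"
  have "objective_M \<U> mon phi \<sigma>
      \<le> ereal (measure_pmf.expectation \<sigma> (\<lambda>X. comp_payoff mon phi X u))"
    unfolding objective_M_def using \<open>u \<in> \<U>\<close> by (intro INF_lower)
  also have "\<dots> = ereal (\<phi> + (1 - \<phi>) * ?p)"
    using \<open>u \<in> \<U>\<close> phi by (simp add: expectation_comp_payoff)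
  also have "\<dots> \<le> ereal (min 1 (\<phi> + (1 - \<phi>) * (real r / real (max_packing_size \<U> \<X> mon))))"
  proof -
    have "(1 - \<phi>) * ?p \<le> (1 - \<phi>) * 1"
      using \<open>\<phi> < 1\<close> by (intro mult_left_mono) auto
    moreover have "(1 - \<phi>) * ?p \<le> (1 - \<phi>) * (real r / real (max_packing_size \<U> \<X> mon))"
      using \<open>\<phi> < 1\<close> prob T(3) by (intro mult_left_mono) auto
    ultimately show ?thesis by simp
  qed
  finally show ?thesis .
qed

section \<open>The uniform strategy on a minimum set cover\<close>

lemma uniform_subset_strategy:
  assumes "finite \<X>" and "C \<subseteq> \<X>" and "r \<le> card C"
  shows "pmf_of_set {X. X \<subseteq> C \<and> card X = r} \<in> strategies \<X> r"
proof -
  have "finite C" using assms finite_subset by blast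
  then have "set_pmf (pmf_of_set {X. X \<subseteq> C \<and> card X = r}) = {X. X \<subseteq> C \<and> card X = r}"
    using assms finite_subsets_of_card[of C r] subsets_of_card_nonempty[of C r]
    by (intro set_pmf_of_set)
  then show ?thesis
    using assms by (auto simp: strategies_def placements_def)
qed

lemma node_basis_uniform_subset:
  assumes "finite C" and "0 < r" and "r \<le> card C"
  shows "node_basis (pmf_of_set {X. X \<subseteq> C \<and> card X = r}) = C"
proof
  let ?F = "{X. X \<subseteq> C \<and> card X = r}"
  have basis: "node_basis (pmf_of_set ?F) = \<Union> ?F"
    using assms finite_subsets_of_card[of C r] subsets_of_card_nonempty[of C r]
    by (simp add: node_basis_def)
  then show "node_basis (pmf_of_set ?F) \<subseteq> C" by auto
  show "C \<subseteq> node_basis (pmf_of_set ?F)"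
  proof
    fix x assume "x \<in> C"
    then have "r - 1 \<le> card (C - {x})" using assms by simp
    then obtain Y where Y: "Y \<subseteq> C - {x}" "card Y = r - 1" "finite Y"
      using obtain_subset_with_card_n by metis
    then have "card (insert x Y) = r" using \<open>0 < r\<close> by (subst card_insert_disjoint) auto
    then have "insert x Y \<in> ?F" using Y \<open>x \<in> C\<close> by auto
    then show "x \<in> node_basis (pmf_of_set ?F)" unfolding basis by blast
  qed
qed

lemma objective_Mbar_uniform_subset:
  assumes cover: "set_cover \<U> \<X> mon C" and "finite C" and "C \<noteq> {}"
    and "0 < r" and "r \<le> card C"
    and mon: "\<forall>x\<in>\<X>. mon x \<noteq> {} \<and> mon x \<subseteq> \<U>"
    and phi: "\<forall>u\<in>\<U>. phi u = \<phi>"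
  shows "objective_Mbar \<U> mon phi (pmf_of_set {X. X \<subseteq> C \<and> card X = r})
    = ereal (\<phi> + (1 - \<phi>) * (real r / real (card C)))"
proof -
  let ?\<sigma> = "pmf_of_set {X. X \<subseteq> C \<and> card X = r}"
  have basis: "node_basis ?\<sigma> = C"
    using assms by (intro node_basis_uniform_subset)
  have "measure_pmf.expectation ?\<sigma> (\<lambda>X. loc_payoff mon phi X x)
      = \<phi> + (1 - \<phi>) * (real r / real (card C))" if "x \<in> C" for x
  proof -
    have "x \<in> \<X>" using that cover by (auto simp: set_cover_def)
    then have "mon x \<noteq> {}" and "\<forall>u\<in>mon x. phi u = \<phi>" using mon phi by auto
    from expectation_loc_payoff[of mon x phi \<phi> ?\<sigma>, OF this] show ?thesis
      unfolding prob_mem_uniform_subset[OF \<open>finite C\<close> \<open>r \<le> card C\<close> that] .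
  qed
  then have "(INF x\<in>C. ereal (measure_pmf.expectation ?\<sigma> (\<lambda>X. loc_payoff mon phi X x)))
      = (INF x\<in>C. ereal (\<phi> + (1 - \<phi>) * (real r / real (card C))))"
    by (intro INF_cong) auto
  moreover have "(INF u\<in>\<U> - monitored mon C. ereal (phi u)) = top"
    using cover by (simp add: set_cover_def)
  ultimately show ?thesis
    unfolding objective_Mbar_def basis using \<open>C \<noteq> {}\<close> by (simp add: top_ereal_def)
qed

text \<open>
  A component seen from \<open>x \<in> C\<close> is monitored whenever \<open>x\<close> carries a sensor.
\<close>

lemma objective_M_uniform_subset_ge:
  assumes cover: "set_cover \<U> \<X> mon C" and "finite C" and "r \<le> card C" and "\<phi> < 1"
    and phi: "\<forall>u\<in>\<U>. phi u = \<phi>"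
  shows "ereal (\<phi> + (1 - \<phi>) * (real r / real (card C)))
    \<le> objective_M \<U> mon phi (pmf_of_set {X. X \<subseteq> C \<and> card X = r})"
  unfolding objective_M_def
proof (rule INF_greatest)
  let ?\<sigma> = "pmf_of_set {X. X \<subseteq> C \<and> card X = r}"
  fix u assume "u \<in> \<U>"
  then obtain x where x: "x \<in> C" "u \<in> mon x"
    using cover by (auto simp: set_cover_def monitored_def)
  have "real r / real (card C) = measure_pmf.prob ?\<sigma> {X. x \<in> X}"
    using prob_mem_uniform_subset[OF \<open>finite C\<close> \<open>r \<le> card C\<close> x(1)] by simp
  also have "\<dots> \<le> measure_pmf.prob ?\<sigma> {X. u \<in> monitored mon X}"
    using x(2) by (intro measure_pmf.finite_measure_mono) (auto simp: monitored_def)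
  finally have "(1 - \<phi>) * (real r / real (card C))
      \<le> (1 - \<phi>) * measure_pmf.prob ?\<sigma> {X. u \<in> monitored mon X}"
    using \<open>\<phi> < 1\<close> by (intro mult_left_mono) auto
  moreover have "measure_pmf.expectation ?\<sigma> (\<lambda>X. comp_payoff mon phi X u)
      = \<phi> + (1 - \<phi>) * measure_pmf.prob ?\<sigma> {X. u \<in> monitored mon X}"
    using \<open>u \<in> \<U>\<close> phi by (intro expectation_comp_payoff) auto
  ultimately show "ereal (\<phi> + (1 - \<phi>) * (real r / real (card C)))
      \<le> ereal (measure_pmf.expectation ?\<sigma> (\<lambda>X. comp_payoff mon phi X u))"
    by simp
qed

section \<open>The optimal values\<close>

lemma z_M_attained:
  assumes "finite \<U>" and "finite \<X>"
  obtains \<sigma> where "\<sigma> \<in> strategies \<X> r" and "z_M \<U> \<X> mon phi r = objective_M \<U> mon phi \<sigma>"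
    and "\<And>\<tau>. \<tau> \<in> strategies \<X> r \<Longrightarrow> objective_M \<U> mon phi \<tau> \<le> z_M \<U> \<X> mon phi r"
proof -
  have "finite (placements \<X> r)"
    using assms by (auto simp: placements_def intro: finite_subset[of _ "Pow \<X>"])
  moreover have "{} \<in> placements \<X> r" by (simp add: placements_def)
  then have "placements \<X> r \<noteq> {}" by blast
  ultimately obtain \<sigma> where \<sigma>: "\<sigma> \<in> strategies \<X> r"
    and max: "\<And>\<tau>. \<tau> \<in> strategies \<X> r \<Longrightarrow> objective_M \<U> mon phi \<tau> \<le> objective_M \<U> mon phi \<sigma>"
    using exists_pmf_maximizing_min_expectation[of "placements \<X> r" \<U> "comp_payoff mon phi"]
      \<open>finite \<U>\<close> unfolding strategies_def objective_M_def by auto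
  have "z_M \<U> \<X> mon phi r = objective_M \<U> mon phi \<sigma>"
    unfolding z_M_def using \<sigma> max by (intro Greatest_equality) auto
  with \<sigma> max that show ?thesis by simp
qed

theorem proposition4:
  fixes \<U> :: "'u set" and \<X> :: "'x set" and mon :: "'x \<Rightarrow> 'u set"
    and phi :: "'u \<Rightarrow> real" and \<phi> :: real and r :: nat
  assumes "finite \<U>" and "finite \<X>"
    and "\<forall>u\<in>\<U>. 0 \<le> phi u \<and> phi u < 1"
    and "\<forall>x\<in>\<X>. mon x \<noteq> {} \<and> mon x \<subseteq> \<U>"
    and "monitored mon \<X> = \<U>"
    and "0 < r" and "r < min_cover_size \<U> \<X> mon"
    and "\<forall>u\<in>\<U>. phi u = \<phi>"
  shows "z_Mbar \<U> \<X> mon phi r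
           = ereal (\<phi> + (1 - \<phi>) * (real r / real (min_cover_size \<U> \<X> mon)))
       \<and> ereal (\<phi> + (1 - \<phi>) * (real r / real (min_cover_size \<U> \<X> mon))) \<le> z_M \<U> \<X> mon phi r
       \<and> z_M \<U> \<X> mon phi r
           \<le> ereal (min 1 (\<phi> + (1 - \<phi>) * (real r / real (max_packing_size \<U> \<X> mon))))"
proof -
  let ?n = "min_cover_size \<U> \<X> mon"
  let ?v = "ereal (\<phi> + (1 - \<phi>) * (real r / real ?n))"
  obtain C where C: "set_cover \<U> \<X> mon C" and card_C: "card C = ?n"
    using obtain_min_cover[OF \<open>finite \<X>\<close> \<open>monitored mon \<X> = \<U>\<close>] .
  have "C \<subseteq> \<X>" using C by (simp add: set_cover_def)
  then have "finite C" using \<open>finite \<X>\<close> finite_subset by blast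
  have "r \<le> card C" using card_C \<open>r < ?n\<close> by simp
  have "C \<noteq> {}" using card_C \<open>r < ?n\<close> by auto
  \<comment> \<open>The empty set covers \<open>{}\<close>, so \<open>r < n\<^sup>*\<close> rules out an empty set of components.\<close>
  have "\<U> \<noteq> {}"
    using min_cover_size_le[OF \<open>finite \<X>\<close>, of \<U> mon "{}"] \<open>r < ?n\<close>
    by (auto simp: set_cover_def monitored_def)
  then have "\<phi> < 1" using assms(3,8) by auto
  define \<sigma> where "\<sigma> = pmf_of_set {X. X \<subseteq> C \<and> card X = r}"
  have \<sigma>: "\<sigma> \<in> strategies \<X> r"
    unfolding \<sigma>_def by (rule uniform_subset_strategy) fact+
  have Mbar: "objective_Mbar \<U> mon phi \<sigma> = ?v"
    unfolding \<sigma>_def card_C[symmetric]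
    by (rule objective_Mbar_uniform_subset) fact+
  have "z_Mbar \<U> \<X> mon phi r = ?v"
    unfolding z_Mbar_def
  proof (rule Greatest_equality)
    show "?v \<in> objective_Mbar \<U> mon phi ` strategies \<X> r"
      using \<sigma> Mbar by (metis imageI)
    show "z \<le> ?v" if "z \<in> objective_Mbar \<U> mon phi ` strategies \<X> r" for z
      using that objective_Mbar_le[OF \<open>finite \<X>\<close> \<open>\<U> \<noteq> {}\<close> \<open>\<phi> < 1\<close> assms(4,8)] by blast
  qed
  moreover obtain \<tau> where \<tau>: "\<tau> \<in> strategies \<X> r"
    and z: "z_M \<U> \<X> mon phi r = objective_M \<U> mon phi \<tau>"
    and max: "\<And>\<rho>. \<rho> \<in> strategies \<X> r \<Longrightarrow> objective_M \<U> mon phi \<rho> \<le> z_M \<U> \<X> mon phi r"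
    using z_M_attained[OF \<open>finite \<U>\<close> \<open>finite \<X>\<close>] by blast
  have "?v \<le> objective_M \<U> mon phi \<sigma>"
    unfolding \<sigma>_def card_C[symmetric]
    by (rule objective_M_uniform_subset_ge) fact+
  then have "?v \<le> z_M \<U> \<X> mon phi r"
    using max[OF \<sigma>] by (rule order_trans)
  moreover have "z_M \<U> \<X> mon phi r
      \<le> ereal (min 1 (\<phi> + (1 - \<phi>) * (real r / real (max_packing_size \<U> \<X> mon))))"
    unfolding z by (rule objective_M_le) fact+
  ultimately show ?thesis by blast
qed

end
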